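(* Let $K$ be a field with $\mathrm{char}(K)=0$, let $n\ge 1$ and $q\in K-\{0\}$. Let $H_n(q)$ (the $q$-Heisenberg algebra) be the $K$-algebra generated by $x_1,\dots,x_n,y_1,\dots,y_n,z_1,\dots,z_n$ subject to the relations $$x_jx_i=x_ix_j,\quad y_jy_i=y_iy_j,\quad z_jz_i=z_iz_j,\quad y_jx_i=x_iy_j,\quad z_iy_j=y_jz_i,\quad z_jx_i=x_iz_j\qquad (i\neq j),$$ $$y_ix_i=qx_iy_i,\qquad z_iy_i=qy_iz_i,\qquad z_ix_i=q^{-1}x_iz_i+y_i\qquad(1\le i\le n).$$ For $1\le i\le n$ let $C_i=(q^2-1)x_iy_iz_i-y_i^2$. Then: 1. If $q$ is not a root of unity, then the elements $C_i$, $1\leq i\leq n$, are central, and $K[C_i]_{1\leq i\leq n}\subseteq Z(H_n(q))$. 2. If $q$ is a root of unity of degree $l$, then the elements $C_i,x_i^l,y_i^l,z_i^l$, $1\le i\le n$, are central, and $K[C_i,x_i^l,y_i^l,z_i^l]_{1\leq i\leq n}\subseteq Z(H_n(q))$.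
   Context: The algebra is the quotient of the free associative $K$-algebra on the $3n$ generators by the stated relations. $Z(\cdot)$ denotes the center. $K[\,\cdot\,]_{1\le i\le n}$ denotes the $K$-subalgebra generated by the listed elements for all $1\le i\le n$. "Root of unity of degree $l$" means primitive $l$-th root of unity.
   Formalization: In item 2, the centrality of x_i^l and z_i^l and the inclusion K[C_i,x_i^l,y_i^l,z_i^l] ⊆ Z(H_n(q)) are stated only for q² ≠ 1, since they fail for q = 1 (l = 1) and q = −1 (l = 2); C_i and y_i^l are central for these q too. *)

theory Defs
  imports
    "HOL-Algebra.Algebra"
    "HOL-Algebra.Algebraic_Closure_Type"
    "HOL-Library.Poly_Mapping"
begin

text \<open>
  Lists under concatenation are the free monoid, so \<open>'g list \<Rightarrow>\<^sub>0 'k\<close> with the convolution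
  product of \<open>Poly_Mapping\<close> is the monoid algebra of the free monoid, i.e. the free
  associative algebra over \<open>'k\<close> on the generators \<open>'g\<close>.
\<close>

instantiation list :: (type) monoid_add
begin

definition zero_list :: "'a list" where "zero_list = []"

definition plus_list :: "'a list \<Rightarrow> 'a list \<Rightarrow> 'a list" where "plus_list = (@)"

instance
  by standard (simp_all add: zero_list_def plus_list_def)

end

definition fgen :: "'g \<Rightarrow> 'g list \<Rightarrow>\<^sub>0 'k::field"
  where "fgen g = Poly_Mapping.single [g] 1"

definition fscal :: "'k::field \<Rightarrow> 'g list \<Rightarrow>\<^sub>0 'k"
  where "fscal c = Poly_Mapping.single [] c"

abbreviation free_algebra :: "('g list \<Rightarrow>\<^sub>0 'k::field) ring"
  where "free_algebra \<equiv> ring_of_type_algebra"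

text \<open>The index set \<open>{1..n}\<close> is rendered by a finite type \<open>'n\<close>, with \<open>n = CARD('n)\<close>.\<close>

datatype 'n gen = GX 'n | GY 'n | GZ 'n

abbreviation fx :: "'n \<Rightarrow> 'n gen list \<Rightarrow>\<^sub>0 'k::field" where "fx i \<equiv> fgen (GX i)"
abbreviation fy :: "'n \<Rightarrow> 'n gen list \<Rightarrow>\<^sub>0 'k::field" where "fy i \<equiv> fgen (GY i)"
abbreviation fz :: "'n \<Rightarrow> 'n gen list \<Rightarrow>\<^sub>0 'k::field" where "fz i \<equiv> fgen (GZ i)"

definition qH_relators :: "'k::field \<Rightarrow> ('n gen list \<Rightarrow>\<^sub>0 'k) set"
  where "qH_relators q =
      {fx j * fx i - fx i * fx j | i j. i \<noteq> j}
    \<union> {fy j * fy i - fy i * fy j | i j. i \<noteq> j}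
    \<union> {fz j * fz i - fz i * fz j | i j. i \<noteq> j}
    \<union> {fy j * fx i - fx i * fy j | i j. i \<noteq> j}
    \<union> {fz i * fy j - fy j * fz i | i j. i \<noteq> j}
    \<union> {fz j * fx i - fx i * fz j | i j. i \<noteq> j}
    \<union> {fy i * fx i - fscal q * fx i * fy i | i. True}
    \<union> {fz i * fy i - fscal q * fy i * fz i | i. True}
    \<union> {fz i * fx i - (fscal (inverse q) * fx i * fz i + fy i) | i. True}"

definition qH_ideal :: "'k::field \<Rightarrow> ('n gen list \<Rightarrow>\<^sub>0 'k) set"
  where "qH_ideal q = genideal free_algebra (qH_relators q)"

definition qHeisenberg :: "'k::field \<Rightarrow> ('n gen list \<Rightarrow>\<^sub>0 'k) set ring"
  where "qHeisenberg q = free_algebra Quot (qH_ideal q)"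

definition qH_class :: "'k::field \<Rightarrow> ('n gen list \<Rightarrow>\<^sub>0 'k) \<Rightarrow> ('n gen list \<Rightarrow>\<^sub>0 'k) set"
  where "qH_class q a = qH_ideal q +>\<^bsub>free_algebra\<^esub> a"

definition qH_x :: "'k::field \<Rightarrow> 'n \<Rightarrow> ('n gen list \<Rightarrow>\<^sub>0 'k) set"
  where "qH_x q i = qH_class q (fx i)"

definition qH_y :: "'k::field \<Rightarrow> 'n \<Rightarrow> ('n gen list \<Rightarrow>\<^sub>0 'k) set"
  where "qH_y q i = qH_class q (fy i)"

definition qH_z :: "'k::field \<Rightarrow> 'n \<Rightarrow> ('n gen list \<Rightarrow>\<^sub>0 'k) set"
  where "qH_z q i = qH_class q (fz i)"

text \<open>The structure map from the ground field to \<open>qHeisenberg q\<close>.\<close>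

definition qH_scal :: "'k::field \<Rightarrow> 'k \<Rightarrow> ('n gen list \<Rightarrow>\<^sub>0 'k) set"
  where "qH_scal q c = qH_class q (fscal c)"

definition qH_C :: "'k::field \<Rightarrow> 'n \<Rightarrow> ('n gen list \<Rightarrow>\<^sub>0 'k) set"
  where "qH_C q i =
    (qH_scal q (q ^ 2 - 1) \<otimes>\<^bsub>qHeisenberg q\<^esub> qH_x q i \<otimes>\<^bsub>qHeisenberg q\<^esub> qH_y q i
        \<otimes>\<^bsub>qHeisenberg q\<^esub> qH_z q i)
      \<ominus>\<^bsub>qHeisenberg q\<^esub> (qH_y q i [^]\<^bsub>qHeisenberg q\<^esub> (2::nat))"

text \<open>The subalgebra \<open>K[S]\<close> is the subring generated by \<open>S\<close> and the image of the ground field.\<close>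

definition qH_subalgebra :: "'k::field \<Rightarrow> ('n gen list \<Rightarrow>\<^sub>0 'k) set set \<Rightarrow> ('n gen list \<Rightarrow>\<^sub>0 'k) set set"
  where "qH_subalgebra q S = generate_ring (qHeisenberg q) (range (qH_scal q) \<union> S)"

definition ring_center :: "('a, 'b) ring_scheme \<Rightarrow> 'a set"
  where "ring_center R =
    {c \<in> carrier R. \<forall>a \<in> carrier R. c \<otimes>\<^bsub>R\<^esub> a = a \<otimes>\<^bsub>R\<^esub> c}"

definition root_of_unity :: "'k::field \<Rightarrow> bool"
  where "root_of_unity q \<longleftrightarrow> (\<exists>l::nat. l \<ge> 1 \<and> q ^ l = 1)"

definition primitive_root_of_unity :: "nat \<Rightarrow> 'k::field \<Rightarrow> bool"
  where "primitive_root_of_unity l q \<longleftrightarrow>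
    l \<ge> 1 \<and> q ^ l = 1 \<and> (\<forall>m. 1 \<le> m \<and> m < l \<longrightarrow> q ^ m \<noteq> 1)"

end

theory Submission
  imports Defs
begin

text \<open>
  An element is central as soon as it commutes with the generators, and those of different
  index commute, so everything reduces to one triple \<open>x, y, z\<close>. Centrality of
  \<open>C\<close> is a short rewriting to the ordered form \<open>x y z\<close>. Since \<open>y\<close> commutes with
  \<open>x\<close> and \<open>z\<close> up to powers of \<open>q\<close>, the only delicate relation is
  \<open>z x\<^sup>m = q\<^sup>-\<^sup>m x\<^sup>m z + c\<^sub>m x\<^sup>m\<^sup>-\<^sup>1 y\<close> (and its mirror image with \<open>z\<^sup>m\<close> and \<open>x\<close>), where
  \<open>c\<^sub>m = (q\<^sup>m\<^sup>+\<^sup>1 - q\<^sup>1\<^sup>-\<^sup>m) / (q\<^sup>2 - 1)\<close> vanishes at \<open>m = l\<close> when \<open>q\<^sup>2 \<noteq> 1\<close>. For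
  \<open>q\<^sup>2 = 1\<close> one gets \<open>c\<^sub>l \<noteq> 0\<close> in characteristic \<open>0\<close> instead, so that case is excluded
  for the powers of \<open>x\<close> and \<open>z\<close>.
\<close>

section \<open>Centers and generated subrings\<close>

text \<open>The center is itself a subring. Scalars being central too, this yields the inclusions of
  whole subalgebras.\<close>

lemma (in ring) generate_ring_subset_center:
  assumes "S \<subseteq> ring_center R"
  shows "generate_ring R S \<subseteq> ring_center R"
proof
  fix c assume "c \<in> generate_ring R S"
  then show "c \<in> ring_center R"
  proof induction
    case one
    show ?case by (simp add: ring_center_def)
  next
    case (incl h)
    then show ?case using assms by blast
  next
    case (a_inv h)
    then show ?case by (simp add: ring_center_def l_minus r_minus)
  next
    case (eng_add h1 h2)
    then show ?case by (simp add: ring_center_def l_distr r_distr)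
  next
    case (eng_mult h1 h2)
    then have carr: "h1 \<in> carrier R" "h2 \<in> carrier R"
      and comm: "\<And>a. a \<in> carrier R \<Longrightarrow> h1 \<otimes> a = a \<otimes> h1" "\<And>a. a \<in> carrier R \<Longrightarrow> h2 \<otimes> a = a \<otimes> h2"
      by (auto simp: ring_center_def)
    have "h1 \<otimes> h2 \<otimes> a = a \<otimes> (h1 \<otimes> h2)" if "a \<in> carrier R" for a
    proof -
      have "h1 \<otimes> h2 \<otimes> a = h1 \<otimes> (a \<otimes> h2)"
        using carr that comm(2)[OF that] by (simp add: m_assoc)
      also have "\<dots> = a \<otimes> h1 \<otimes> h2"
        using carr that comm(1)[OF that] by (simp flip: m_assoc)
      finally show ?thesis
        using carr that by (simp add: m_assoc)
    qed
    then show ?case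
      using carr by (simp add: ring_center_def)
  qed
qed

section \<open>Rings satisfying the one-variable relations\<close>

text \<open>A \<open>K\<close>-algebra as a ring with a homomorphism \<open>sc\<close> from the
  field into the center: scalar multiples become ordinary products.\<close>

locale central_scalars = ring R for R (structure) +
  fixes sc :: "'k::field \<Rightarrow> 'a"
  assumes sc_closed [simp]: "sc c \<in> carrier R"
    and sc_one: "sc 1 = \<one>"
    and sc_add: "sc (c + d) = sc c \<oplus> sc d"
    and sc_mult: "sc (c * d) = sc c \<otimes> sc d"
    and sc_commute: "a \<in> carrier R \<Longrightarrow> a \<otimes> sc c = sc c \<otimes> a"
begin

lemma sc_left_commute:
  "a \<in> carrier R \<Longrightarrow> b \<in> carrier R \<Longrightarrow> a \<otimes> (sc c \<otimes> b) = sc c \<otimes> (a \<otimes> b)"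
  by (metis m_assoc sc_closed sc_commute)

lemma sc_sc: "a \<in> carrier R \<Longrightarrow> sc c \<otimes> (sc d \<otimes> a) = sc (c * d) \<otimes> a"
  by (simp add: sc_mult m_assoc)

lemma sc_zero: "sc 0 = \<zero>"
  using sc_add[of 0 0] by (metis add.r_cancel_one' add_0 sc_closed)

lemma sc_collect: "a \<in> carrier R \<Longrightarrow> sc c \<otimes> a \<oplus> sc d \<otimes> a = sc (c + d) \<otimes> a"
  by (simp add: sc_add l_distr)

lemma sc_minus: "a \<in> carrier R \<Longrightarrow> \<ominus> a = sc (-1) \<otimes> a"
proof -
  assume a: "a \<in> carrier R"
  have "sc (-1) \<otimes> a \<oplus> a = \<zero>"
    using sc_collect[OF a, of "-1" 1] a by (simp add: sc_one sc_zero)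
  then show ?thesis
    using a by (simp add: minus_equality)
qed

text \<open>Each of the \<open>m\<close> factors \<open>a\<close> that \<open>b\<close> passes
  contributes one \<open>q\<close>. Meant for the pairs \<open>(x, y)\<close> and
  \<open>(y, z)\<close>.\<close>

lemma q_commute_pow_right:
  assumes "a \<in> carrier R" "b \<in> carrier R" "b \<otimes> a = sc q \<otimes> (a \<otimes> b)"
  shows "b \<otimes> a [^] (m::nat) = sc (q ^ m) \<otimes> (a [^] m \<otimes> b)"
proof (induction m)
  case 0
  then show ?case using assms by (simp add: sc_one)
next
  case (Suc m)
  have "b \<otimes> a [^] Suc m = (b \<otimes> a [^] m) \<otimes> a"
    using assms by (simp add: m_assoc)
  also have "\<dots> = sc (q ^ m) \<otimes> (a [^] m \<otimes> (b \<otimes> a))"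
    using assms(1,2) by (simp add: Suc m_assoc)
  also have "\<dots> = sc (q ^ Suc m) \<otimes> (a [^] Suc m \<otimes> b)"
    using assms(1,2) by (simp add: assms(3) m_assoc power_commutes sc_sc sc_left_commute[of "_ [^] _"])
  finally show ?case .
qed

lemma q_commute_pow_left:
  assumes "a \<in> carrier R" "b \<in> carrier R" "b \<otimes> a = sc q \<otimes> (a \<otimes> b)"
  shows "b [^] (m::nat) \<otimes> a = sc (q ^ m) \<otimes> (a \<otimes> b [^] m)"
proof (induction m)
  case 0
  then show ?case using assms by (simp add: sc_one)
next
  case (Suc m)
  have "b [^] Suc m \<otimes> a = b [^] m \<otimes> (b \<otimes> a)"
    using assms by (simp add: m_assoc)
  also have "\<dots> = sc q \<otimes> ((b [^] m \<otimes> a) \<otimes> b)"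
    using assms(1,2) by (simp add: assms(3) m_assoc sc_sc sc_left_commute[of "_ [^] _"])
  also have "\<dots> = sc (q ^ Suc m) \<otimes> (a \<otimes> b [^] Suc m)"
    using assms(1,2) by (simp add: Suc m_assoc sc_sc)
  finally show ?case .
qed

end

text \<open>Working with elements of an arbitrary ring keeps the computations free of
  cosets.\<close>

locale q_heisenberg_triple = central_scalars R sc
  for R (structure) and sc :: "'k::field \<Rightarrow> 'a" +
  fixes q :: 'k and x y z
  assumes q_nonzero: "q \<noteq> 0"
    and closed [simp]: "x \<in> carrier R" "y \<in> carrier R" "z \<in> carrier R"
    and yx: "y \<otimes> x = sc q \<otimes> (x \<otimes> y)"
    and zy: "z \<otimes> y = sc q \<otimes> (y \<otimes> z)"
    and zx: "z \<otimes> x = sc (inverse q) \<otimes> (x \<otimes> z) \<oplus> y"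
begin

section \<open>Centrality of \<open>C\<close> within one triple\<close>

definition Cas where "Cas = sc (q\<^sup>2 - 1) \<otimes> (x \<otimes> (y \<otimes> z)) \<oplus> sc (-1) \<otimes> (y \<otimes> y)"

lemma Cas_closed [simp]: "Cas \<in> carrier R"
  by (simp add: Cas_def)

text \<open>Products are kept right-nested, so each relation also needs a form that fires at the
  head of a longer product.\<close>

lemma yx_left: "a \<in> carrier R \<Longrightarrow> y \<otimes> (x \<otimes> a) = sc q \<otimes> (x \<otimes> (y \<otimes> a))"
  using yx by (metis closed m_assoc m_closed sc_closed)

lemma zy_left: "a \<in> carrier R \<Longrightarrow> z \<otimes> (y \<otimes> a) = sc q \<otimes> (y \<otimes> (z \<otimes> a))"
  using zy by (metis closed m_assoc m_closed sc_closed)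

lemma zx_left:
  assumes "a \<in> carrier R"
  shows "z \<otimes> (x \<otimes> a) = sc (inverse q) \<otimes> (x \<otimes> (z \<otimes> a)) \<oplus> y \<otimes> a"
proof -
  have "z \<otimes> (x \<otimes> a) = (z \<otimes> x) \<otimes> a"
    using assms by (simp add: m_assoc)
  then show ?thesis
    using assms by (simp add: zx l_distr m_assoc)
qed

lemmas scalars_left =
  closed[THEN sc_left_commute] closed[THEN nat_pow_closed, THEN sc_left_commute] sc_sc

text \<open>On its way to the front \<open>x\<close> picks up \<open>inverse q\<close> at
  \<open>z\<close> and \<open>q\<close> at \<open>y\<close>; these cancel and only the correction
  \<open>y \<otimes> y\<close> survives.\<close>

lemma yzx: "y \<otimes> (z \<otimes> x) = x \<otimes> (y \<otimes> z) \<oplus> y \<otimes> y"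
proof -
  have "y \<otimes> (z \<otimes> x) = sc (inverse q) \<otimes> (y \<otimes> (x \<otimes> z)) \<oplus> y \<otimes> y"
    by (simp add: zx r_distr scalars_left)
  then show ?thesis
    using q_nonzero by (simp add: yx_left sc_sc sc_one)
qed

lemma zxyz: "z \<otimes> (x \<otimes> (y \<otimes> z)) = x \<otimes> (y \<otimes> (z \<otimes> z)) \<oplus> y \<otimes> (y \<otimes> z)"
proof -
  have "z \<otimes> (x \<otimes> (y \<otimes> z)) = sc (inverse q) \<otimes> (x \<otimes> (z \<otimes> (y \<otimes> z))) \<oplus> y \<otimes> (y \<otimes> z)"
    by (rule zx_left) simp
  then show ?thesis
    using q_nonzero by (simp add: zy_left scalars_left sc_one)
qed

lemma yyx: "y \<otimes> (y \<otimes> x) = sc (q\<^sup>2) \<otimes> (x \<otimes> (y \<otimes> y))"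
  by (simp add: yx yx_left scalars_left power2_eq_square)

lemma zyy: "z \<otimes> (y \<otimes> y) = sc (q\<^sup>2) \<otimes> (y \<otimes> (y \<otimes> z))"
  by (simp add: zy zy_left scalars_left power2_eq_square)

lemma Cas_x: "Cas \<otimes> x = x \<otimes> Cas"
proof -
  have "Cas \<otimes> x = sc (q\<^sup>2 - 1) \<otimes> (x \<otimes> (y \<otimes> (z \<otimes> x))) \<oplus> sc (-1) \<otimes> (y \<otimes> (y \<otimes> x))"
    by (simp add: Cas_def l_distr m_assoc)
  \<comment> \<open>The coefficients of \<open>x \<otimes> (y \<otimes> y)\<close> add up to
    \<open>(q^2 - 1) - q^2 = -1\<close>.\<close>
  also have "\<dots> = sc (q\<^sup>2 - 1) \<otimes> (x \<otimes> (x \<otimes> (y \<otimes> z))) \<oplus> sc (-1) \<otimes> (x \<otimes> (y \<otimes> y))"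
    unfolding yzx yyx by (simp add: r_distr a_assoc sc_sc sc_collect)
  also have "\<dots> = x \<otimes> Cas"
    by (simp add: Cas_def r_distr scalars_left)
  finally show ?thesis .
qed

lemma Cas_y: "Cas \<otimes> y = y \<otimes> Cas"
proof -
  have "Cas \<otimes> y = sc (q\<^sup>2 - 1) \<otimes> (x \<otimes> (y \<otimes> (z \<otimes> y))) \<oplus> sc (-1) \<otimes> (y \<otimes> (y \<otimes> y))"
    by (simp add: Cas_def l_distr m_assoc)
  \<comment> \<open>Reordering \<open>z \<otimes> y\<close> on one side and
    \<open>y \<otimes> x\<close> on the other releases the same factor \<open>q\<close>.\<close>
  also have "\<dots> = sc (q\<^sup>2 - 1) \<otimes> (y \<otimes> (x \<otimes> (y \<otimes> z))) \<oplus> sc (-1) \<otimes> (y \<otimes> (y \<otimes> y))"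
    by (simp add: zy yx_left scalars_left)
  also have "\<dots> = y \<otimes> Cas"
    by (simp add: Cas_def r_distr scalars_left)
  finally show ?thesis .
qed

lemma Cas_z: "Cas \<otimes> z = z \<otimes> Cas"
proof -
  \<comment> \<open>The computation starts from this side because the relations move
    \<open>z\<close> to the right.\<close>
  have "z \<otimes> Cas = sc (q\<^sup>2 - 1) \<otimes> (z \<otimes> (x \<otimes> (y \<otimes> z))) \<oplus> sc (-1) \<otimes> (z \<otimes> (y \<otimes> y))"
    by (simp add: Cas_def r_distr scalars_left)
  also have "\<dots> = sc (q\<^sup>2 - 1) \<otimes> (x \<otimes> (y \<otimes> (z \<otimes> z))) \<oplus> sc (-1) \<otimes> (y \<otimes> (y \<otimes> z))"
    unfolding zxyz zyy by (simp add: r_distr a_assoc sc_sc sc_collect)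
  also have "\<dots> = Cas \<otimes> z"
    by (simp add: Cas_def l_distr m_assoc)
  finally show ?thesis by (rule sym)
qed

section \<open>Passing \<open>z\<close> across powers of \<open>x\<close>, and powers of
  \<open>z\<close> across \<open>x\<close>\<close>

text \<open>\<open>qcoeff m\<close> is \<open>q\<^sup>m + q\<^sup>m\<^sup>-\<^sup>2 + \<dots> + q\<^sup>-\<^sup>m\<close> in closed form (junk value \<open>0\<close> if \<open>q\<^sup>2 = 1\<close>).\<close>
definition qcoeff :: "nat \<Rightarrow> 'k"
  where "qcoeff m = (q ^ (m + 2) - inverse q ^ m) / (q\<^sup>2 - 1)"

lemma qcoeff_0: "q\<^sup>2 \<noteq> 1 \<Longrightarrow> qcoeff 0 = 1"
  by (simp add: qcoeff_def flip: power2_eq_square)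

text \<open>For one more \<open>x\<close>, the first summand is the new \<open>y\<close> produced by
  \<open>zx\<close>; the second is the earlier \<open>y\<close>-term, which gains \<open>q\<close>
  on passing \<open>x\<close>.\<close>

lemma qcoeff_Suc:
  assumes "q\<^sup>2 \<noteq> 1"
  shows "qcoeff (Suc m) = inverse q ^ Suc m + q * qcoeff m"
proof -
  have "q\<^sup>2 - 1 \<noteq> 0" using assms by simp
  then show ?thesis
    using q_nonzero unfolding qcoeff_def
    by (simp add: field_simps power2_eq_square)
qed

text \<open>Modulo \<open>m + 1\<close> the exponents \<open>m + 2\<close> and \<open>-m\<close> are
  both \<open>1\<close>, so the two powers in the numerator equal \<open>q\<close> and
  cancel.\<close>

lemma qcoeff_root:
  assumes "q ^ Suc m = 1"
  shows "qcoeff m = 0"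
proof -
  have "q ^ (m + 2) = q" using assms by (simp add: algebra_simps)
  moreover have "inverse q ^ m = q"
    using assms q_nonzero by (simp add: field_simps)
  ultimately show ?thesis by (simp add: qcoeff_def)
qed

text \<open>The index is shifted: \<open>qcoeff m\<close> is the coefficient \<open>c\<close> with
  index \<open>m + 1\<close> of the opening text, which avoids a truncated
  \<open>m - 1\<close>.\<close>

lemma z_pow_x:
  assumes "q\<^sup>2 \<noteq> 1"
  shows "z \<otimes> x [^] Suc m
    = sc (inverse q ^ Suc m) \<otimes> (x [^] Suc m \<otimes> z) \<oplus> sc (qcoeff m) \<otimes> (x [^] m \<otimes> y)"
proof (induction m)
  case 0
  then show ?case using assms by (simp add: zx qcoeff_0 sc_one)
next
  case (Suc m)
  have "z \<otimes> x [^] Suc (Suc m) = (z \<otimes> x [^] Suc m) \<otimes> x"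
    by (simp add: m_assoc)
  also have "\<dots> = sc (inverse q ^ Suc m) \<otimes> (x [^] Suc m \<otimes> (z \<otimes> x))
      \<oplus> sc (qcoeff m) \<otimes> (x [^] m \<otimes> (y \<otimes> x))"
    unfolding Suc by (simp add: m_assoc l_distr)
  also have "\<dots> = sc (inverse q ^ Suc (Suc m)) \<otimes> (x [^] Suc (Suc m) \<otimes> z)
      \<oplus> (sc (inverse q ^ Suc m) \<otimes> (x [^] Suc m \<otimes> y) \<oplus> sc (qcoeff m * q) \<otimes> (x [^] Suc m \<otimes> y))"
    by (simp add: zx yx m_assoc r_distr scalars_left a_assoc mult.assoc power_commutes)
  finally show ?case
    by (simp add: sc_collect qcoeff_Suc[OF assms] mult.commute[of q "qcoeff m"])
qed

lemma z_pow_x':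
  assumes "q\<^sup>2 \<noteq> 1"
  shows "z [^] Suc m \<otimes> x
    = sc (inverse q ^ Suc m) \<otimes> (x \<otimes> z [^] Suc m) \<oplus> sc (qcoeff m) \<otimes> (y \<otimes> z [^] m)"
proof (induction m)
  case 0
  then show ?case using assms by (simp add: zx qcoeff_0 sc_one)
next
  case (Suc m)
  \<comment> \<open>Powers grow on the right by definition, but the extra \<open>z\<close> must be
    split off on the left to act on the induction hypothesis.\<close>
  have pow: "z [^] Suc k = z \<otimes> z [^] k" for k
    by (rule nat_pow_Suc2) simp
  have "z [^] Suc (Suc m) \<otimes> x = z \<otimes> (z [^] Suc m \<otimes> x)"
    by (subst pow) (simp add: m_assoc)
  also have "\<dots> = sc (inverse q ^ Suc m) \<otimes> ((z \<otimes> x) \<otimes> z [^] Suc m)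
      \<oplus> sc (qcoeff m) \<otimes> ((z \<otimes> y) \<otimes> z [^] m)"
    unfolding Suc by (simp add: m_assoc r_distr scalars_left)
  also have "\<dots> = sc (inverse q ^ Suc (Suc m)) \<otimes> (x \<otimes> z [^] Suc (Suc m))
      \<oplus> (sc (inverse q ^ Suc m) \<otimes> (y \<otimes> z [^] Suc m) \<oplus> sc (qcoeff m * q) \<otimes> (y \<otimes> z [^] Suc m))"
    unfolding pow by (simp add: zx zy m_assoc l_distr r_distr scalars_left a_assoc mult.assoc power_commutes)
  finally show ?case
    by (simp add: sc_collect qcoeff_Suc[OF assms] mult.commute[of q "qcoeff m"])
qed

section \<open>Powers at a root of unity\<close>

context
  fixes l :: nat
  assumes root: "q ^ l = 1"
begin

lemma y_root_pow: "y [^] l \<otimes> x = x \<otimes> y [^] l" "y [^] l \<otimes> z = z \<otimes> y [^] l"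
  using q_commute_pow_left[OF _ _ yx, of l] q_commute_pow_right[OF _ _ zy, of l]
  by (simp_all add: root sc_one)

lemma x_root_pow_y: "x [^] l \<otimes> y = y \<otimes> x [^] l"
  using q_commute_pow_right[OF _ _ yx, of l] by (simp add: root sc_one)

lemma z_root_pow_y: "z [^] l \<otimes> y = y \<otimes> z [^] l"
  using q_commute_pow_left[OF _ _ zy, of l] by (simp add: root sc_one)

text \<open>For \<open>l = Suc m\<close> the leading scalar is \<open>1\<close> and the
  \<open>y\<close>-term vanishes. At \<open>q = 1\<close>, \<open>l = 1\<close> the difference of
  \<open>z \<otimes> x\<close> and \<open>x \<otimes> z\<close> is \<open>y\<close>, hence the
  assumption on \<open>q\<close>.\<close>

lemma
  assumes "q\<^sup>2 \<noteq> 1" "l \<ge> 1"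
  shows x_root_pow_z: "x [^] l \<otimes> z = z \<otimes> x [^] l"
    and z_root_pow_x: "z [^] l \<otimes> x = x \<otimes> z [^] l"
proof -
  obtain m where l: "l = Suc m" using assms(2) by (cases l) auto
  have "inverse q ^ Suc m = 1" "qcoeff m = 0"
    using root qcoeff_root unfolding l by (simp_all only: power_inverse inverse_1)
  then show "x [^] l \<otimes> z = z \<otimes> x [^] l" "z [^] l \<otimes> x = x \<otimes> z [^] l"
    unfolding l z_pow_x[OF assms(1)] z_pow_x'[OF assms(1)]
    by (simp_all del: nat_pow_Suc power_Suc add: sc_one sc_zero nat_pow_closed)
qed

end

end

section \<open>The quotient of the free algebra\<close>

lemma fscal_add: "fscal (c + d) = fscal c + fscal d"
  by (simp add: fscal_def single_add)

lemma fscal_mult: "fscal (c * d) = fscal c * fscal d"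
  by (simp add: fscal_def mult_single plus_list_def)

lemma fscal_one: "fscal 1 = 1"
  by (simp add: fscal_def flip: single_one zero_list_def)

text \<open>A word is a product of generators, so induction on words reaches every monomial; adding
  monomials one at a time reaches every element.\<close>

lemma free_algebra_induct [case_names scal gen add mult]:
  fixes p :: "'g list \<Rightarrow>\<^sub>0 'k::field"
  assumes scal: "\<And>c. P (fscal c)" and gen: "\<And>g. P (fgen g)"
    and add: "\<And>a b. P a \<Longrightarrow> P b \<Longrightarrow> P (a + b)"
    and mult: "\<And>a b. P a \<Longrightarrow> P b \<Longrightarrow> P (a * b)"
  shows "P p"
proof -
  have mono: "P (Poly_Mapping.single w c)" for w and c :: 'k
  proof (induction w arbitrary: c)
    case Nil
    show ?case using scal[of c] by (simp add: fscal_def)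
  next
    case (Cons g w)
    have "Poly_Mapping.single (g # w) c = fgen g * Poly_Mapping.single w c"
      by (simp add: fgen_def mult_single plus_list_def)
    then show ?case using mult[OF gen Cons] by simp
  qed
  show ?thesis
  proof (induction p rule: update_induct)
    case const
    show ?case using mono[of "[]" 0] by simp
  next
    case (update f w c)
    \<comment> \<open>\<open>w\<close> is not yet a key of \<open>f\<close>, so overwriting its
      coefficient amounts to adding a monomial.\<close>
    have "Poly_Mapping.update w c f = Poly_Mapping.single w c + f"
      using update(1)
      by (intro poly_mapping_eqI) (auto simp: lookup_update lookup_add lookup_single when_def in_keys_iff)
    then show ?case using add[OF mono update(3)] by simp
  qed
qed

lemma fscal_commute: "a * fscal c = fscal c * a"
proof (induction a rule: free_algebra_induct)
  case (scal d)
  show ?case by (metis fscal_mult mult.commute)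
next
  case (gen g)
  show ?case by (simp add: fgen_def fscal_def mult_single plus_list_def)
next
  case (add a b)
  then show ?case by (simp add: algebra_simps)
next
  case (mult a b)
  then show ?case by (metis mult.assoc)
qed

text \<open>The library has the corresponding fact only for commutative rings.\<close>
lemma ring_of_type_algebra_ring: "ring (ring_of_type_algebra :: 'a::ring_1 ring)"
proof -
  have "\<exists>y. x + y = 0" for x :: 'a
    using add.right_inverse by blast
  then show ?thesis
    unfolding ring_of_type_algebra_def using add.right_inverse
    by unfold_locales (auto simp: algebra_simps Units_def)
qed

context
  fixes q :: "'k::field" and H :: "('n gen list \<Rightarrow>\<^sub>0 'k) set ring"
  defines "H \<equiv> qHeisenberg q"
begin

lemma qH_ideal_ideal: "ideal (qH_ideal q) (free_algebra :: ('n gen list \<Rightarrow>\<^sub>0 'k) ring)"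
  unfolding qH_ideal_def
  by (rule ring.genideal_ideal[OF ring_of_type_algebra_ring]) (simp add: ring_of_type_algebra_def)

lemma qH_class_hom: "qH_class q \<in> ring_hom (free_algebra :: ('n gen list \<Rightarrow>\<^sub>0 'k) ring) H"
  using ideal.rcos_ring_hom[OF qH_ideal_ideal] unfolding H_def qHeisenberg_def qH_class_def .

lemma qH_ring: "ring H"
  unfolding H_def qHeisenberg_def by (rule ideal.quotient_is_ring[OF qH_ideal_ideal])

lemma qH_class_closed: "qH_class q a \<in> carrier H"
  and qH_class_mult: "qH_class q (a * b) = qH_class q a \<otimes>\<^bsub>H\<^esub> qH_class q b"
  and qH_class_add: "qH_class q (a + b) = qH_class q a \<oplus>\<^bsub>H\<^esub> qH_class q b"
  and qH_class_one: "qH_class q 1 = \<one>\<^bsub>H\<^esub>"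
  using ring_hom_memE[OF qH_class_hom] by (simp_all add: ring_of_type_algebra_def)

lemma qH_carrierE:
  assumes "a \<in> carrier H"
  obtains p where "a = qH_class q p"
  using assms
  by (auto simp: H_def qHeisenberg_def qH_class_def FactRing_def A_RCOSETS_def' ring_of_type_algebra_def)

lemma qH_class_eqI:
  fixes a b :: "'n gen list \<Rightarrow>\<^sub>0 'k"
  assumes "a - b \<in> qH_relators q"
  shows "qH_class q a = qH_class q b"
proof -
  interpret F: ring "free_algebra :: ('n gen list \<Rightarrow>\<^sub>0 'k) ring"
    by (rule ring_of_type_algebra_ring)
  have carr: "carrier (free_algebra :: ('n gen list \<Rightarrow>\<^sub>0 'k) ring) = UNIV"
    by (simp add: ring_of_type_algebra_def)
  \<comment> \<open>The record operation \<open>\<ominus>\<close> uses the abstract additive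
    inverse; adding \<open>b\<close> back identifies it with \<open>-\<close> of the type.\<close>
  have "a \<ominus>\<^bsub>free_algebra\<^esub> b \<oplus>\<^bsub>free_algebra\<^esub> b = a"
    by (simp add: F.minus_eq F.a_assoc F.l_neg carr)
  then have "a \<ominus>\<^bsub>free_algebra\<^esub> b = a - b"
    by (simp add: ring_of_type_algebra_def algebra_simps)
  then have "a \<ominus>\<^bsub>free_algebra\<^esub> b \<in> qH_ideal q"
    using assms F.genideal_self[of "qH_relators q"] carr by (auto simp: qH_ideal_def)
  then show ?thesis
    using F.quotient_eq_iff_same_a_r_cos[OF qH_ideal_ideal] carr by (auto simp: qH_class_def)
qed

text \<open>Every element is the class of some \<open>p\<close>, so centrality of scalars descends
  from \<open>fscal_commute\<close>.\<close>

lemma qH_central_scalars: "central_scalars H (qH_scal q)"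
proof -
  interpret ring H by (rule qH_ring)
  show ?thesis
  proof unfold_locales
    fix a c assume "a \<in> carrier H"
    then obtain p where "a = qH_class q p" by (rule qH_carrierE)
    then show "a \<otimes>\<^bsub>H\<^esub> qH_scal q c = qH_scal q c \<otimes>\<^bsub>H\<^esub> a"
      by (simp add: qH_scal_def fscal_commute[of p] flip: qH_class_mult)
  qed (simp_all add: qH_scal_def qH_class_closed fscal_one qH_class_one fscal_add qH_class_add
      fscal_mult qH_class_mult)
qed

lemma qH_scal_center: "qH_scal q c \<in> ring_center H"
  using central_scalars.sc_commute[OF qH_central_scalars] central_scalars.sc_closed[OF qH_central_scalars]
  by (simp add: ring_center_def)

lemma qH_gens_closed: "qH_x q i \<in> carrier H" "qH_y q i \<in> carrier H" "qH_z q i \<in> carrier H"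
  by (simp_all add: qH_x_def qH_y_def qH_z_def qH_class_closed)

lemma qH_triple:
  assumes "q \<noteq> 0"
  shows "q_heisenberg_triple H (qH_scal q) q (qH_x q i) (qH_y q i) (qH_z q i)"
proof -
  interpret central_scalars H "qH_scal q" by (rule qH_central_scalars)
  have "qH_class q (fy i * fx i) = qH_class q (fscal q * fx i * fy i)"
    "qH_class q (fz i * fy i) = qH_class q (fscal q * fy i * fz i)"
    "qH_class q (fz i * fx i) = qH_class q (fscal (inverse q) * fx i * fz i + fy i)"
    by (rule qH_class_eqI; unfold qH_relators_def; blast)+
  then show ?thesis
    using assms
    by unfold_locales
      (simp_all add: qH_gens_closed, simp_all add: qH_x_def qH_y_def qH_z_def qH_scal_def
        qH_class_mult qH_class_add qH_class_closed m_assoc)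
qed

lemma qH_commute_distinct:
  assumes "i \<noteq> j"
  shows "u \<in> {qH_x q i, qH_y q i, qH_z q i} \<Longrightarrow> v \<in> {qH_x q j, qH_y q j, qH_z q j}
    \<Longrightarrow> u \<otimes>\<^bsub>H\<^esub> v = v \<otimes>\<^bsub>H\<^esub> u"
proof -
  have rel: "qH_class q (fx j * fx i) = qH_class q (fx i * fx j)"
    "qH_class q (fy j * fy i) = qH_class q (fy i * fy j)"
    "qH_class q (fz j * fz i) = qH_class q (fz i * fz j)"
    "qH_class q (fy j * fx i) = qH_class q (fx i * fy j)"
    "qH_class q (fz i * fy j) = qH_class q (fy j * fz i)"
    "qH_class q (fz j * fx i) = qH_class q (fx i * fz j)" if "i \<noteq> j" for i j :: 'n
    by (rule qH_class_eqI; unfold qH_relators_def; use that in blast)+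
  show "u \<in> {qH_x q i, qH_y q i, qH_z q i} \<Longrightarrow> v \<in> {qH_x q j, qH_y q j, qH_z q j}
    \<Longrightarrow> u \<otimes>\<^bsub>H\<^esub> v = v \<otimes>\<^bsub>H\<^esub> u"
    \<comment> \<open>The relators treat a mixed pair such as \<open>y\<close>, \<open>x\<close> in
      one order only; exchanging \<open>i\<close> and \<open>j\<close> supplies the other.\<close>
    using rel[OF assms] rel[OF assms[symmetric]]
    by (auto simp: qH_x_def qH_y_def qH_z_def simp flip: qH_class_mult)
qed

section \<open>Central elements of the quotient\<close>

lemma qH_centerI:
  assumes c: "c \<in> carrier H"
    and gens: "\<And>j v. v \<in> {qH_x q j, qH_y q j, qH_z q j} \<Longrightarrow> c \<otimes>\<^bsub>H\<^esub> v = v \<otimes>\<^bsub>H\<^esub> c"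
  shows "c \<in> ring_center H"
proof -
  interpret central_scalars H "qH_scal q" by (rule qH_central_scalars)
  have "c \<otimes>\<^bsub>H\<^esub> qH_class q p = qH_class q p \<otimes>\<^bsub>H\<^esub> c" for p
  proof (induction p rule: free_algebra_induct)
    case (scal d)
    show ?case using sc_commute[OF c] by (simp add: qH_scal_def)
  next
    case (gen g)
    show ?case
      using gens by (cases g) (auto simp: qH_x_def qH_y_def qH_z_def)
  next
    case (add a b)
    then show ?case using c by (simp add: qH_class_add qH_class_closed l_distr r_distr)
  next
    case (mult a b)
    then show ?case using c by (simp add: qH_class_mult) (metis m_assoc qH_class_closed)
  qed
  then show ?thesis
    using c by (auto simp: ring_center_def elim!: qH_carrierE)
qed

text \<open>Commutation with generators of other indices passes from \<open>u\<close> to its powers,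
  which leaves only its own triple to check.\<close>

lemma qH_pow_center:
  assumes u: "u \<in> {qH_x q i, qH_y q i, qH_z q i}"
    and same: "\<And>v. v \<in> {qH_x q i, qH_y q i, qH_z q i}
      \<Longrightarrow> u [^]\<^bsub>H\<^esub> (l::nat) \<otimes>\<^bsub>H\<^esub> v = v \<otimes>\<^bsub>H\<^esub> u [^]\<^bsub>H\<^esub> l"
  shows "u [^]\<^bsub>H\<^esub> l \<in> ring_center H"
proof -
  interpret ring H by (rule qH_ring)
  have carr: "w \<in> carrier H" if "w \<in> {qH_x q j, qH_y q j, qH_z q j}" for w j
    using that qH_gens_closed by auto
  show ?thesis
  proof (rule qH_centerI)
    show "u [^]\<^bsub>H\<^esub> l \<in> carrier H" using carr[OF u] by simp
    fix j :: 'n and v assume v: "v \<in> {qH_x q j, qH_y q j, qH_z q j}"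
    show "u [^]\<^bsub>H\<^esub> l \<otimes>\<^bsub>H\<^esub> v = v \<otimes>\<^bsub>H\<^esub> u [^]\<^bsub>H\<^esub> l"
    proof (cases "i = j")
      case True
      then show ?thesis using same v by simp
    next
      case False
      then show ?thesis
        using group_commutes_pow[OF qH_commute_distinct[OF False u v]] carr[OF u] carr[OF v] by simp
    qed
  qed
qed

lemma qH_C_center:
  assumes "q \<noteq> 0"
  shows "qH_C q i \<in> ring_center H"
proof -
  interpret q_heisenberg_triple H "qH_scal q" q "qH_x q i" "qH_y q i" "qH_z q i"
    by (rule qH_triple[OF assms])
  have C: "qH_C q i = Cas"
    by (simp add: qH_C_def Cas_def minus_eq sc_minus m_assoc numeral_2_eq_2 flip: H_def)
  show ?thesis
  proof (rule qH_centerI)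
    show "qH_C q i \<in> carrier H" by (simp add: C)
    fix j :: 'n and v assume v: "v \<in> {qH_x q j, qH_y q j, qH_z q j}"
    show "qH_C q i \<otimes>\<^bsub>H\<^esub> v = v \<otimes>\<^bsub>H\<^esub> qH_C q i"
    proof (cases "i = j")
      case True
      then have "v \<in> {qH_x q i, qH_y q i, qH_z q i}" using v by simp
      then show ?thesis unfolding C using Cas_x Cas_y Cas_z by blast
    next
      case False
      have [simp]: "v \<in> carrier H" using v qH_gens_closed by auto
      have comm: "w \<otimes>\<^bsub>H\<^esub> v = v \<otimes>\<^bsub>H\<^esub> w" if "w \<in> {qH_x q i, qH_y q i, qH_z q i}" for w
        by (rule qH_commute_distinct[OF False that v])
      \<comment> \<open>The form of \<open>comm\<close> for right-nested products: \<open>v\<close>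
        moves to the front past each factor of \<open>Cas\<close>.\<close>
      have left: "w \<otimes>\<^bsub>H\<^esub> (v \<otimes>\<^bsub>H\<^esub> a) = v \<otimes>\<^bsub>H\<^esub> (w \<otimes>\<^bsub>H\<^esub> a)"
        if "w \<in> {qH_x q i, qH_y q i, qH_z q i}" "a \<in> carrier H" for w a
        using that comm[OF that(1)] closed by (metis \<open>v \<in> carrier H\<close> insertE m_assoc singletonD)
      show ?thesis
        by (simp add: C Cas_def l_distr r_distr m_assoc sc_left_commute[of v] comm left)
    qed
  qed
qed

lemma qH_subalgebra_center:
  assumes "S \<subseteq> ring_center H"
  shows "qH_subalgebra q S \<subseteq> ring_center H"
  unfolding qH_subalgebra_def H_def[symmetric]
  by (rule ring.generate_ring_subset_center[OF qH_ring]) (use assms qH_scal_center in blast)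

text \<open>The \<open>y\<close> case rests on q-commutation alone; for \<open>x\<close> and
  \<open>z\<close> the coefficient \<open>qcoeff\<close> enters, whence
  \<open>q\<^sup>2 \<noteq> 1\<close>.\<close>

lemma qH_root_pow_center:
  assumes "q \<noteq> 0" "q ^ l = 1"
  shows "qH_y q i [^]\<^bsub>H\<^esub> l \<in> ring_center H"
    and "q\<^sup>2 \<noteq> 1 \<Longrightarrow> l \<ge> 1 \<Longrightarrow> qH_x q i [^]\<^bsub>H\<^esub> l \<in> ring_center H"
    and "q\<^sup>2 \<noteq> 1 \<Longrightarrow> l \<ge> 1 \<Longrightarrow> qH_z q i [^]\<^bsub>H\<^esub> l \<in> ring_center H"
proof -
  interpret q_heisenberg_triple H "qH_scal q" q "qH_x q i" "qH_y q i" "qH_z q i"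
    by (rule qH_triple[OF assms(1)])
  have self: "w [^]\<^bsub>H\<^esub> l \<otimes>\<^bsub>H\<^esub> w = w \<otimes>\<^bsub>H\<^esub> w [^]\<^bsub>H\<^esub> l" if "w \<in> carrier H" for w
    using that by (intro group_commutes_pow[OF refl])
  show "qH_y q i [^]\<^bsub>H\<^esub> l \<in> ring_center H"
    by (rule qH_pow_center[of _ i]) (use y_root_pow[OF assms(2)] self closed in blast)+
  show "qH_x q i [^]\<^bsub>H\<^esub> l \<in> ring_center H" if "q\<^sup>2 \<noteq> 1" "l \<ge> 1"
    by (rule qH_pow_center[of _ i])
      (use x_root_pow_y[OF assms(2)] x_root_pow_z[OF assms(2) that] self closed in blast)+
  show "qH_z q i [^]\<^bsub>H\<^esub> l \<in> ring_center H" if "q\<^sup>2 \<noteq> 1" "l \<ge> 1"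
    by (rule qH_pow_center[of _ i])
      (use z_root_pow_y[OF assms(2)] z_root_pow_x[OF assms(2) that] self closed in blast)+
qed

end

theorem theorem3p7:
  fixes q :: "'k::field_char_0"
    and H :: "('n::finite gen list \<Rightarrow>\<^sub>0 'k) set ring"
    and C x y z :: "'n \<Rightarrow> ('n gen list \<Rightarrow>\<^sub>0 'k) set"
  defines "H \<equiv> qHeisenberg q"
    and "C \<equiv> qH_C q" and "x \<equiv> qH_x q" and "y \<equiv> qH_y q" and "z \<equiv> qH_z q"
  assumes "q \<noteq> 0"
  shows
    "(\<not> root_of_unity q \<longrightarrow>
        (\<forall>i. C i \<in> ring_center H) \<and>
        qH_subalgebra q (\<Union>i. {C i}) \<subseteq> ring_center H)
     \<and>
     (\<forall>l. primitive_root_of_unity l q \<longrightarrow>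
        (\<forall>i. C i \<in> ring_center H \<and> y i [^]\<^bsub>H\<^esub> l \<in> ring_center H) \<and>
        (q ^ 2 \<noteq> 1 \<longrightarrow>
          (\<forall>i. x i [^]\<^bsub>H\<^esub> l \<in> ring_center H \<and> z i [^]\<^bsub>H\<^esub> l \<in> ring_center H) \<and>
          qH_subalgebra q (\<Union>i. {C i, x i [^]\<^bsub>H\<^esub> l, y i [^]\<^bsub>H\<^esub> l, z i [^]\<^bsub>H\<^esub> l})
            \<subseteq> ring_center H))"
proof -
  note defs = H_def C_def x_def y_def z_def
  have C: "C i \<in> ring_center H" for i
    unfolding defs by (rule qH_C_center[OF \<open>q \<noteq> 0\<close>])
  have sub: "qH_subalgebra q S \<subseteq> ring_center H" if "S \<subseteq> ring_center H" for S
    using that unfolding defs by (rule qH_subalgebra_center)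
  have y: "y i [^]\<^bsub>H\<^esub> l \<in> ring_center H" if "primitive_root_of_unity l q" for i and l :: nat
    using that unfolding defs primitive_root_of_unity_def
    by (intro qH_root_pow_center(1) \<open>q \<noteq> 0\<close>) simp
  have x: "x i [^]\<^bsub>H\<^esub> l \<in> ring_center H" and z: "z i [^]\<^bsub>H\<^esub> l \<in> ring_center H"
    if "primitive_root_of_unity l q" "q\<^sup>2 \<noteq> 1" for i and l :: nat
    using that unfolding defs primitive_root_of_unity_def
    by (intro qH_root_pow_center(2,3) \<open>q \<noteq> 0\<close>; simp)+
  show ?thesis
    using C x y z by (intro conjI impI allI sub) auto
qed

end
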